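(* Let $p$ be an odd prime, let $G=\langle a,b,c \mid a^p=b^p=c^p=1,\ [a,b]=c,\ [c,a]=[c,b]=1\rangle$, and let $S=\{a^i,b^i\mid 1\leq i\leq p-1\}$. Let $\mathrm{Cos}(G,\langle a\rangle,\langle b\rangle)$ be the graph with vertex set $\{\langle a\rangle g\mid g\in G\}\cup\{\langle b\rangle h\mid h\in G\}$ and with edges all the coset pairs $\{\langle a\rangle g,\langle b\rangle h\}$ having non-empty intersection in $G$ (that is, $\langle a\rangle g\cap\langle b\rangle h\neq\emptyset$). Then $\mathrm{Cay}(G,S)$ is the line graph of $\mathrm{Cos}(G,\langle a\rangle,\langle b\rangle)$, and $\mathrm{Cos}(G,\langle a\rangle,\langle b\rangle)$ is $3$-arc-transitive.
   Context: All graphs are finite, simple and undirected. Here $[x,y]=x^{-1}y^{-1}xy$. For a finite group $G$ and $S\subseteq G\setminus\{1\}$ with $S=S^{-1}$, the Cayley graph $\mathrm{Cay}(G,S)$ has vertex set $G$, with $g,h$ adjacent if and only if $hg^{-1}\in S$. The line graph of a graph $\Sigma$ has the edges of $\Sigma$ as vertices, two distinct edges being adjacent when they share an endpoint; "is the line graph" is understood up to graph isomorphism. An $s$-arc of a graph $\Sigma$ is a sequence $v_0,v_1,\dots,v_s$ of vertices such that $v_{i-1},v_i$ are adjacent for $1\le i\le s$ and $v_{i-1}\neq v_{i+1}$ for $1\le i\le s-1$. $\Sigma$ is $s$-arc-transitive if it has at least one $s$-arc and its full automorphism group $\mathrm{Aut}(\Sigma)$ is transitive on the set of $s$-arcs of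 $\Sigma$. *)

theory Defs
  imports
    "HOL-Computational_Algebra.Primes"
    "HOL-Algebra.Generated_Groups"
    "Graph_Theory.Pair_Digraph"
    "Graph_Theory.Digraph_Isomorphism"
begin

section \<open>Groups given by generators and relations\<close>

text \<open>A letter \<open>(x, True)\<close> stands for the generator \<open>x\<close> and \<open>(x, False)\<close> for its formal inverse.\<close>

type_synonym 'g word = "('g \<times> bool) list"

definition word_inv :: "'g word \<Rightarrow> 'g word" where
  "word_inv w = rev (map (\<lambda>(x, e). (x, \<not> e)) w)"

text \<open>The convention is \<open>[x, y] = x\<^sup>-\<^sup>1 y\<^sup>-\<^sup>1 x y\<close>.\<close>

definition word_commutator :: "'g word \<Rightarrow> 'g word \<Rightarrow> 'g word" where
  "word_commutator u v = word_inv u @ word_inv v @ u @ v"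

text \<open>A pair \<open>(u, v)\<close> in \<open>R\<close> is the defining relation \<open>u = v\<close>. The relation below is the least
  congruence on words containing \<open>R\<close> and free cancellation; its quotient is the free group on
  the type \<open>'g\<close> modulo the normal closure of all \<open>u v\<^sup>-\<^sup>1\<close> with \<open>(u, v)\<close> in \<open>R\<close>.\<close>

inductive pres_eq :: "('g word \<times> 'g word) set \<Rightarrow> 'g word \<Rightarrow> 'g word \<Rightarrow> bool"
  for R :: "('g word \<times> 'g word) set" where
  rel: "(u, v) \<in> R \<Longrightarrow> pres_eq R u v"
| cancel: "pres_eq R [(x, e), (x, \<not> e)] []"
| refl: "pres_eq R u u"
| sym: "pres_eq R u v \<Longrightarrow> pres_eq R v u"
| trans: "pres_eq R u v \<Longrightarrow> pres_eq R v w \<Longrightarrow> pres_eq R u w"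
| append: "pres_eq R u v \<Longrightarrow> pres_eq R u' v' \<Longrightarrow> pres_eq R (u @ u') (v @ v')"

definition pres_class :: "('g word \<times> 'g word) set \<Rightarrow> 'g word \<Rightarrow> 'g word set" where
  "pres_class R w = {v. pres_eq R w v}"

definition presented_group :: "('g word \<times> 'g word) set \<Rightarrow> 'g word set monoid" where
  "presented_group R = \<lparr>
     carrier = range (pres_class R),
     monoid.mult = (\<lambda>A B. \<Union>u\<in>A. \<Union>v\<in>B. pres_class R (u @ v)),
     monoid.one = pres_class R [] \<rparr>"

definition pres_gen :: "('g word \<times> 'g word) set \<Rightarrow> 'g \<Rightarrow> 'g word set" where
  "pres_gen R x = pres_class R [(x, True)]"

lemma pres_class_eq_iff: "pres_class R u = pres_class R v \<longleftrightarrow> pres_eq R u v"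
  unfolding pres_class_def by (blast intro: pres_eq.refl pres_eq.sym pres_eq.trans)

lemma presented_group_mult:
  "pres_class R u \<otimes>\<^bsub>presented_group R\<^esub> pres_class R v = pres_class R (u @ v)"
  unfolding presented_group_def pres_class_def
  by (auto intro: pres_eq.refl pres_eq.trans pres_eq.append)

lemma pres_eq_word_inv: "pres_eq R (word_inv w @ w) []"
proof (induction w)
  case Nil
  show ?case by (simp add: word_inv_def pres_eq.refl)
next
  case (Cons l w)
  obtain x e where l: "l = (x, e)" by (cases l)
  have "pres_eq R [(x, \<not> e), (x, e)] []" using pres_eq.cancel[of R x "\<not> e"] by simp
  then have "pres_eq R (word_inv w @ [(x, \<not> e), (x, e)] @ w) (word_inv w @ [] @ w)"
    by (intro pres_eq.append pres_eq.refl)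
  then show ?case using Cons.IH pres_eq.trans by (fastforce simp: l word_inv_def)
qed

lemma group_presented_group: "group (presented_group R)"
proof (rule groupI)
  have one: "\<one>\<^bsub>presented_group R\<^esub> = pres_class R []" by (simp add: presented_group_def)
  have car: "carrier (presented_group R) = range (pres_class R)" by (simp add: presented_group_def)
  show "\<one>\<^bsub>presented_group R\<^esub> \<in> carrier (presented_group R)" by (simp add: one car)
  fix x assume x: "x \<in> carrier (presented_group R)"
  then obtain u where u: "x = pres_class R u" by (auto simp: car)
  show "\<one>\<^bsub>presented_group R\<^esub> \<otimes>\<^bsub>presented_group R\<^esub> x = x"
    by (simp add: one u presented_group_mult)
  have "pres_class R (word_inv u) \<otimes>\<^bsub>presented_group R\<^esub> x = \<one>\<^bsub>presented_group R\<^esub>"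
    by (simp add: one u presented_group_mult pres_class_eq_iff pres_eq_word_inv)
  then show "\<exists>y\<in>carrier (presented_group R). y \<otimes>\<^bsub>presented_group R\<^esub> x = \<one>\<^bsub>presented_group R\<^esub>"
    by (auto simp: car)
  fix y assume "y \<in> carrier (presented_group R)"
  then obtain v where v: "y = pres_class R v" by (auto simp: car)
  show "x \<otimes>\<^bsub>presented_group R\<^esub> y \<in> carrier (presented_group R)"
    by (simp add: car u v presented_group_mult)
  fix z assume "z \<in> carrier (presented_group R)"
  then obtain w where w: "z = pres_class R w" by (auto simp: car)
  show "x \<otimes>\<^bsub>presented_group R\<^esub> y \<otimes>\<^bsub>presented_group R\<^esub> z
      = x \<otimes>\<^bsub>presented_group R\<^esub> (y \<otimes>\<^bsub>presented_group R\<^esub> z)"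
    by (simp add: u v w presented_group_mult)
qed

datatype gen = Gen_a | Gen_b | Gen_c

definition extraspecial_relations :: "nat \<Rightarrow> (gen word \<times> gen word) set" where
  "extraspecial_relations p =
    (let a = [(Gen_a, True)]; b = [(Gen_b, True)]; c = [(Gen_c, True)] in
     {(concat (replicate p a), []), (concat (replicate p b), []), (concat (replicate p c), []),
      (word_commutator a b, c), (word_commutator c a, []), (word_commutator c b, [])})"


section \<open>Graphs\<close>

text \<open>Finite simple undirected graphs are rendered by the locale \<open>pair_graph\<close>: finite vertex set,
  no loops, and a symmetric set of arcs \<open>(u, v)\<close>, with \<open>(u, v)\<close> an arc iff \<open>u\<close> and \<open>v\<close> are
  adjacent. For pair digraphs, \<open>digraph_iso\<close> is then graph isomorphism.\<close>

text \<open>For a group \<open>G\<close> and \<open>S\<close> contained in \<open>carrier G\<close>, this is loop-free iff \<open>S\<close> omits \<open>\<one>\<close>, and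
  symmetric iff \<open>S\<close> is closed under inverses.\<close>

definition Cay :: "('a, 'm) monoid_scheme \<Rightarrow> 'a set \<Rightarrow> 'a pair_pre_digraph" where
  "Cay G S = \<lparr>
     pverts = carrier G,
     parcs = {(g, h). g \<in> carrier G \<and> h \<in> carrier G \<and> h \<otimes>\<^bsub>G\<^esub> inv\<^bsub>G\<^esub> g \<in> S} \<rparr>"

text \<open>In HOL-Algebra, \<open>rcosets\<^bsub>G\<^esub> H\<close> is the set of cosets \<open>H g\<close>.\<close>

definition Cos :: "('a, 'm) monoid_scheme \<Rightarrow> 'a set \<Rightarrow> 'a set \<Rightarrow> 'a set pair_pre_digraph" where
  "Cos G H K = \<lparr>
     pverts = rcosets\<^bsub>G\<^esub> H \<union> rcosets\<^bsub>G\<^esub> K,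
     parcs = {(A, B). (A \<in> rcosets\<^bsub>G\<^esub> H \<and> B \<in> rcosets\<^bsub>G\<^esub> K
                     \<or> A \<in> rcosets\<^bsub>G\<^esub> K \<and> B \<in> rcosets\<^bsub>G\<^esub> H) \<and> A \<inter> B \<noteq> {}} \<rparr>"

definition edges :: "'a pair_pre_digraph \<Rightarrow> 'a set set" where
  "edges \<Sigma> = {{u, v} | u v. (u, v) \<in> parcs \<Sigma>}"

definition line_graph :: "'a pair_pre_digraph \<Rightarrow> 'a set pair_pre_digraph" where
  "line_graph \<Sigma> = \<lparr>
     pverts = edges \<Sigma>,
     parcs = {(e, f). e \<in> edges \<Sigma> \<and> f \<in> edges \<Sigma> \<and> e \<noteq> f \<and> e \<inter> f \<noteq> {}} \<rparr>"

definition graph_automorphism :: "'a pair_pre_digraph \<Rightarrow> ('a \<Rightarrow> 'a) \<Rightarrow> bool" where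
  "graph_automorphism \<Sigma> f \<longleftrightarrow>
     bij_betw f (pverts \<Sigma>) (pverts \<Sigma>) \<and>
     (\<forall>u\<in>pverts \<Sigma>. \<forall>v\<in>pverts \<Sigma>. (f u, f v) \<in> parcs \<Sigma> \<longleftrightarrow> (u, v) \<in> parcs \<Sigma>)"

definition s_arc :: "'a pair_pre_digraph \<Rightarrow> nat \<Rightarrow> 'a list \<Rightarrow> bool" where
  "s_arc \<Sigma> s vs \<longleftrightarrow>
     length vs = s + 1 \<and> set vs \<subseteq> pverts \<Sigma> \<and>
     (\<forall>i\<in>{1..s}. (vs ! (i - 1), vs ! i) \<in> parcs \<Sigma>) \<and>
     (\<forall>i. 1 \<le> i \<and> i < s \<longrightarrow> vs ! (i - 1) \<noteq> vs ! (i + 1))"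

definition s_arc_transitive :: "'a pair_pre_digraph \<Rightarrow> nat \<Rightarrow> bool" where
  "s_arc_transitive \<Sigma> s \<longleftrightarrow>
     (\<exists>vs. s_arc \<Sigma> s vs) \<and>
     (\<forall>vs ws. s_arc \<Sigma> s vs \<longrightarrow> s_arc \<Sigma> s ws \<longrightarrow>
        (\<exists>f. graph_automorphism \<Sigma> f \<and> map f vs = ws))"

end

theory Submission
  imports
    Defs
    "HOL-Algebra.Multiplicative_Group"
    "HOL-Algebra.Elementary_Groups"
    "HOL-Number_Theory.Cong"
begin

text \<open>Since \<open>\<langle>a\<rangle> \<inter> \<langle>b\<rangle> = 1\<close>, an edge of the coset graph is \<open>{\<langle>a\<rangle> g, \<langle>b\<rangle> g}\<close> for a unique \<open>g\<close>, and two
  such edges share an endpoint iff the quotient of their elements lies in \<open>\<langle>a\<rangle> \<union> \<langle>b\<rangle>\<close>. Up to reversal,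
  a 3-arc is the translate by some \<open>x\<close> of one through \<open>\<langle>b\<rangle> h, \<langle>a\<rangle>, \<langle>b\<rangle>, \<langle>a\<rangle> k\<close> with \<open>h \<in> \<langle>a\<rangle>\<close> and
  \<open>k \<in> \<langle>b\<rangle>\<close> nontrivial. Right translations, the automorphisms \<open>a \<mapsto> a\<^sup>i\<close>, \<open>b \<mapsto> b\<^sup>j\<close> and the exchange
  of \<open>a\<close> and \<open>b\<close> are therefore transitive on 3-arcs. These automorphisms come from the universal
  property of the presentation; they are bijective because the normal form \<open>b\<^sup>j a\<^sup>i c\<^sup>k\<close> makes the
  group finite and generated by \<open>a\<close> and \<open>b\<close>.\<close>

section \<open>Coset graphs\<close>

lemma graph_automorphism_comp:
  assumes "graph_automorphism \<Sigma> f" "graph_automorphism \<Sigma> g"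
  shows "graph_automorphism \<Sigma> (g \<circ> f)"
  using assms unfolding graph_automorphism_def
  by (auto intro: bij_betw_trans dest: bij_betwE)

lemma graph_automorphism_inv_into:
  assumes f: "graph_automorphism \<Sigma> f"
  shows "graph_automorphism \<Sigma> (inv_into (pverts \<Sigma>) f)"
proof -
  let ?V = "pverts \<Sigma>" and ?g = "inv_into (pverts \<Sigma>) f"
  have bij: "bij_betw f ?V ?V" using f by (simp add: graph_automorphism_def)
  have "?g u \<in> ?V \<and> f (?g u) = u" if "u \<in> ?V" for u
    using bij_betw_inv_into_right[OF bij that] bij_betwE[OF bij_betw_inv_into[OF bij]] that by blast
  then show ?thesis
    using f bij_betw_inv_into[OF bij] unfolding graph_automorphism_def by metis
qed

text \<open>Automorphisms are closed under composition and inverses, so one base arc is enough: an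
  arc \<open>vs\<close> is first carried back to \<open>us\<close> and from there to
  \<open>ws\<close>.\<close>

lemma s_arc_transitiveI:
  assumes "s_arc \<Sigma> s us"
    and images: "\<And>vs. s_arc \<Sigma> s vs \<Longrightarrow> \<exists>f. graph_automorphism \<Sigma> f \<and> map f us = vs"
  shows "s_arc_transitive \<Sigma> s"
  unfolding s_arc_transitive_def
proof (intro conjI allI impI)
  show "\<exists>vs. s_arc \<Sigma> s vs" using assms(1) by blast
  fix vs ws assume "s_arc \<Sigma> s vs" "s_arc \<Sigma> s ws"
  with images obtain f g where f: "graph_automorphism \<Sigma> f" "map f us = vs"
    and g: "graph_automorphism \<Sigma> g" "map g us = ws" by metis
  let ?f' = "inv_into (pverts \<Sigma>) f"
  have "set us \<subseteq> pverts \<Sigma>" using assms(1) by (simp add: s_arc_def)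
  moreover have "?f' (f u) = u" if "u \<in> pverts \<Sigma>" for u
    using f(1) that unfolding graph_automorphism_def by (blast intro: bij_betw_inv_into_left)
  ultimately have "map ?f' vs = us" unfolding f(2)[symmetric] by (auto intro!: map_idI)
  then have "map (g \<circ> ?f') vs = ws" using g(2) by (metis map_map)
  then show "\<exists>f. graph_automorphism \<Sigma> f \<and> map f vs = ws"
    using graph_automorphism_comp[OF graph_automorphism_inv_into[OF f(1)] g(1)] by blast
qed

lemma s_arc_3_iff:
  "s_arc \<Sigma> 3 vs \<longleftrightarrow> (\<exists>t u v w. vs = [t, u, v, w] \<and> {t, u, v, w} \<subseteq> pverts \<Sigma> \<and>
     (t, u) \<in> parcs \<Sigma> \<and> (u, v) \<in> parcs \<Sigma> \<and> (v, w) \<in> parcs \<Sigma> \<and> t \<noteq> v \<and> u \<noteq> w)"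
proof -
  have idx: "{1..3::nat} = {1, 2, 3}" "\<And>i::nat. 1 \<le> i \<and> i < 3 \<longleftrightarrow> i = 1 \<or> i = 2" by auto
  have len: "length vs = 3 + 1 \<longleftrightarrow> (\<exists>t u v w. vs = [t, u, v, w])"
    by (auto simp: length_Suc_conv numeral_3_eq_3)
  show ?thesis
    unfolding s_arc_def idx len by (auto simp: numeral_2_eq_2 numeral_3_eq_3)
qed

text \<open>\<open>digraph_iso\<close> works with a record that maps vertices and arcs separately.
  In pair digraphs the arc map has to be \<open>map_prod f f\<close>, and it reaches every arc of
  \<Delta> because the ends of such an arc are vertices, hence values of \<open>f\<close>.\<close>

lemma digraph_iso_with_projI:
  assumes wf: "wf_digraph (with_proj \<Gamma>)"
    and bij: "bij_betw f (pverts \<Gamma>) (pverts \<Delta>)"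
    and \<Delta>: "parcs \<Delta> \<subseteq> pverts \<Delta> \<times> pverts \<Delta>"
    and adj: "\<And>u v. u \<in> pverts \<Gamma> \<Longrightarrow> v \<in> pverts \<Gamma> \<Longrightarrow> (f u, f v) \<in> parcs \<Delta> \<longleftrightarrow> (u, v) \<in> parcs \<Gamma>"
  shows "digraph_iso (with_proj \<Gamma>) (with_proj \<Delta>)"
proof -
  have sub: "parcs \<Gamma> \<subseteq> pverts \<Gamma> \<times> pverts \<Gamma>"
    using wf by (force simp: wf_digraph_def)
  have inj: "inj_on f (pverts \<Gamma>)" and surj: "f ` pverts \<Gamma> = pverts \<Delta>"
    using bij by (auto simp: bij_betw_def)
  let ?h = "\<lparr>iso_verts = f, iso_arcs = map_prod f f, iso_head = snd, iso_tail = fst\<rparr>"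
  have "pre_digraph.digraph_isomorphism (with_proj \<Gamma>) ?h"
    using wf inj inj_on_subset[OF map_prod_inj_on[OF inj inj] sub]
    by (auto simp: pre_digraph.digraph_isomorphism_def)
  moreover have "map_prod f f ` parcs \<Gamma> = parcs \<Delta>"
  proof
    show "map_prod f f ` parcs \<Gamma> \<subseteq> parcs \<Delta>" using sub adj by auto
    show "parcs \<Delta> \<subseteq> map_prod f f ` parcs \<Gamma>"
    proof
      fix e assume e: "e \<in> parcs \<Delta>"
      then have "e \<in> f ` pverts \<Gamma> \<times> f ` pverts \<Gamma>" using \<Delta> surj by auto
      then obtain u v where uv: "e = (f u, f v)" "u \<in> pverts \<Gamma>" "v \<in> pverts \<Gamma>" by blast
      with e adj have "(u, v) \<in> parcs \<Gamma>" by simp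
      with uv show "e \<in> map_prod f f ` parcs \<Gamma>" by force
    qed
  qed
  then have "with_proj \<Delta> = app_iso ?h (with_proj \<Gamma>)"
    using surj by (simp add: app_iso_def with_proj_def)
  ultimately show ?thesis unfolding digraph_iso_def by blast
qed

section \<open>Right cosets and the arcs of the coset graph\<close>

context group
begin

lemma rcosets_disjoint_or_eq:
  assumes "subgroup H G" "A \<in> rcosets H" "B \<in> rcosets H" "x \<in> A" "x \<in> B"
  shows "A = B"
  using rcos_disjoint[OF assms(1)] assms(2-) by (auto simp: pairwise_def disjnt_def)

lemma rcos_eq_iff:
  assumes H: "subgroup H G" and "x \<in> carrier G" "y \<in> carrier G"
  shows "H #> x = H #> y \<longleftrightarrow> y \<otimes> inv x \<in> H"
proof -
  have "H #> x = H #> y \<longleftrightarrow> y \<in> H #> x"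
    using assms repr_independence repr_independenceD by blast
  also have "\<dots> \<longleftrightarrow> y \<otimes> inv x \<in> H"
    using subgroup.rcos_module[OF H is_group] assms by blast
  finally show ?thesis .
qed

text \<open>A coset determines its subgroup: a representative \<open>x\<close> over \<open>H\<close>
  also represents the set over \<open>K\<close>, and translating back by \<open>inv x\<close> yields
  both subgroups. This keeps the two vertex classes of the coset graph apart.\<close>

lemma rcosets_common_imp_eq:
  assumes H: "subgroup H G" and K: "subgroup K G" and "A \<in> rcosets H" "A \<in> rcosets K"
  shows "H = K"
proof -
  obtain x y where x: "x \<in> carrier G" "A = H #> x" and y: "y \<in> carrier G" "A = K #> y"
    using assms(3,4) by (auto simp: RCOSETS_def)
  have "x \<in> K #> y" using x y rcos_self[OF x(1) H] by simp
  then have "H #> x = K #> x" using x y repr_independence[OF _ y(1) K] by simp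
  then have "(H #> x) #> inv x = (K #> x) #> inv x" by simp
  then show ?thesis
    using H K x(1) by (simp add: coset_mult_assoc subgroup.subset)
qed

text \<open>Any element \<open>g\<close> of the intersection represents both cosets, so group
  elements together with a direction parametrise the arcs.\<close>

lemma mem_parcs_Cos_iff:
  assumes "subgroup H G" "subgroup K G"
  shows "(A, B) \<in> parcs (Cos G H K) \<longleftrightarrow>
    (\<exists>g\<in>carrier G. A = H #> g \<and> B = K #> g \<or> A = K #> g \<and> B = H #> g)"
proof
  assume "(A, B) \<in> parcs (Cos G H K)"
  then obtain g L M where LM: "L = H \<and> M = K \<or> L = K \<and> M = H"
    and A: "A \<in> rcosets L" and B: "B \<in> rcosets M" and g: "g \<in> A" "g \<in> B"
    by (auto simp: Cos_def)
  have sub: "subgroup L G" "subgroup M G" using LM assms by auto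
  have gG: "g \<in> carrier G" using A g(1) rcosets_part_G[OF sub(1)] by blast
  have "C = N #> g" if "C \<in> rcosets N" "g \<in> C" "subgroup N G" for C N
    using rcosets_disjoint_or_eq[OF that(3,1) rcosetsI[OF subgroup.subset gG] that(2)] that(3) gG rcos_self
    by blast
  then have "A = L #> g" "B = M #> g" using A B g sub by auto
  with LM gG show "\<exists>g\<in>carrier G. A = H #> g \<and> B = K #> g \<or> A = K #> g \<and> B = H #> g" by blast
next
  assume "\<exists>g\<in>carrier G. A = H #> g \<and> B = K #> g \<or> A = K #> g \<and> B = H #> g"
  then show "(A, B) \<in> parcs (Cos G H K)"
    using assms rcos_self[of _ H] rcos_self[of _ K]
    by (fastforce simp: Cos_def intro!: rcosetsI subgroup.subset)
qed

section \<open>Coset and Cayley graphs as simple graphs, and the line graph isomorphism\<close>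

lemma pair_graph_Cos:
  assumes fin: "finite (carrier G)" and H: "subgroup H G" and K: "subgroup K G" and "H \<noteq> K"
  shows "pair_graph (Cos G H K)"
proof -
  have verts: "pverts (Cos G H K) \<subseteq> Pow (carrier G)"
    using rcosets_subset_PowG H K by (auto simp: Cos_def)
  have sub: "parcs (Cos G H K) \<subseteq> pverts (Cos G H K) \<times> pverts (Cos G H K)"
    by (auto simp: Cos_def)
  have finV: "finite (pverts (Cos G H K))" using fin verts by (meson finite_Pow_iff finite_subset)
  show ?thesis
  proof unfold_locales
    show "finite (parcs (Cos G H K))" using finV sub by (meson finite_SigmaI finite_subset)
    show "symmetric (with_proj (Cos G H K))"
      by (auto simp: symmetric_def sym_def Cos_def)
    \<comment> \<open>The vertex carrying a loop would be a coset of both subgroups.\<close>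
    show "fst e \<noteq> snd e" if "e \<in> parcs (Cos G H K)" for e
      using that rcosets_common_imp_eq[OF H K] \<open>H \<noteq> K\<close> by (auto simp: Cos_def)
  qed (use sub finV in force)+
qed

lemma pair_graph_Cay:
  assumes fin: "finite (carrier G)" and "\<one> \<notin> S" and inv: "\<And>s. s \<in> S \<Longrightarrow> inv s \<in> S"
  shows "pair_graph (Cay G S)"
proof unfold_locales
  show "finite (pverts (Cay G S))" using fin by (simp add: Cay_def)
  show "finite (parcs (Cay G S))"
    by (rule finite_subset[of _ "carrier G \<times> carrier G"]) (use fin in \<open>auto simp: Cay_def\<close>)
  show "fst e \<noteq> snd e" if "e \<in> parcs (Cay G S)" for e
    using that \<open>\<one> \<notin> S\<close> by (auto simp: Cay_def)
  have "g \<otimes> inv h \<in> S" if "g \<in> carrier G" "h \<in> carrier G" "h \<otimes> inv g \<in> S" for g h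
    using inv[OF that(3)] that by (simp add: inv_mult_group)
  then show "symmetric (with_proj (Cay G S))"
    by (auto simp: symmetric_def sym_def Cay_def)
qed (auto simp: Cay_def)

text \<open>The isomorphism sends \<open>g\<close> to the edge \<open>{H #> g, K #> g}\<close>.
  Elements with the same edge differ by a factor in \<open>H \<inter> K\<close>, and two edges meet
  exactly when their \<open>H\<close>-cosets or their \<open>K\<close>-cosets agree.\<close>

theorem Cay_iso_line_graph_Cos:
  assumes fin: "finite (carrier G)" and H: "subgroup H G" and K: "subgroup K G"
    and HK: "H \<inter> K = {\<one>}" and "H \<noteq> K"
  shows "digraph_iso (with_proj (Cay G (H \<union> K - {\<one>}))) (with_proj (line_graph (Cos G H K)))"
proof -
  let ?S = "H \<union> K - {\<one>}" and ?f = "\<lambda>g. {H #> g, K #> g}"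
  interpret \<Gamma>: pair_graph "Cay G ?S"
  proof (rule pair_graph_Cay[OF fin])
    show "inv s \<in> ?S" if "s \<in> ?S" for s
      using that H K by (auto simp: subgroup.m_inv_closed dest: subgroup.mem_carrier)
  qed simp
  \<comment> \<open>No \<open>H\<close>-coset is a \<open>K\<close>-coset, so edges can only be
    compared class by class.\<close>
  have ne: "H #> x \<noteq> K #> y" if "x \<in> carrier G" "y \<in> carrier G" for x y
    using that rcosets_common_imp_eq[OF H K] \<open>H \<noteq> K\<close> H K by (metis rcosetsI subgroup.subset)
  have edges: "edges (Cos G H K) = ?f ` carrier G"
    unfolding edges_def mem_parcs_Cos_iff[OF H K] by auto
  have f_eq: "?f x = ?f y \<longleftrightarrow> x = y" if "x \<in> carrier G" "y \<in> carrier G" for x y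
  proof
    assume "?f x = ?f y"
    then have "H #> x = H #> y" "K #> x = K #> y"
      using ne that by (auto simp: doubleton_eq_iff)
    then have "y \<otimes> inv x \<in> H \<inter> K" using that H K by (simp add: rcos_eq_iff)
    then show "x = y" using HK that by (metis inv_equality inv_inv inv_closed singletonD)
  qed simp
  show ?thesis
  proof (rule digraph_iso_with_projI[where f = ?f])
    show "wf_digraph (with_proj (Cay G ?S))" by (rule \<Gamma>.wf_digraph_axioms)
    show "bij_betw ?f (pverts (Cay G ?S)) (pverts (line_graph (Cos G H K)))"
      using f_eq by (auto simp: bij_betw_def inj_on_def Cay_def line_graph_def edges)
    show "parcs (line_graph (Cos G H K))
        \<subseteq> pverts (line_graph (Cos G H K)) \<times> pverts (line_graph (Cos G H K))"
      by (auto simp: line_graph_def)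
    fix x y assume "x \<in> pverts (Cay G ?S)" "y \<in> pverts (Cay G ?S)"
    then have xy: "x \<in> carrier G" "y \<in> carrier G" by (auto simp: Cay_def)
    have "(?f x, ?f y) \<in> parcs (line_graph (Cos G H K))
        \<longleftrightarrow> x \<noteq> y \<and> (H #> x = H #> y \<or> K #> x = K #> y)"
      using xy f_eq ne[OF xy] ne[OF xy(2,1)] by (auto simp: line_graph_def edges)
    \<comment> \<open>Removing \<open>\<one>\<close> from the connection set corresponds to the
      condition \<open>x \<noteq> y\<close>.\<close>
    also have "\<dots> \<longleftrightarrow> y \<otimes> inv x \<in> ?S"
      using xy H K by (auto simp: rcos_eq_iff dest: inv_equality)
    finally show "(?f x, ?f y) \<in> parcs (line_graph (Cos G H K)) \<longleftrightarrow> (x, y) \<in> parcs (Cay G ?S)"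
      using xy by (auto simp: Cay_def)
  qed
qed

section \<open>Affine maps as automorphisms of the coset graph\<close>

lemma image_rcos_affine:
  assumes \<phi>: "\<phi> \<in> iso G G" and "L \<subseteq> carrier G" "g \<in> carrier G" "x \<in> carrier G"
  shows "(\<lambda>y. \<phi> y \<otimes> x) ` (L #> g) = (\<phi> ` L) #> (\<phi> g \<otimes> x)"
proof -
  have "\<phi> (l \<otimes> g) \<otimes> x = \<phi> l \<otimes> (\<phi> g \<otimes> x)" if "l \<in> L" for l
    using that assms by (auto simp: iso_iff hom_mult hom_in_carrier m_assoc subset_iff)
  then show ?thesis unfolding r_coset_def by (auto simp: image_iff)
qed

lemma bij_betw_affine:
  assumes \<phi>: "\<phi> \<in> iso G G" and x: "x \<in> carrier G"
  shows "bij_betw (\<lambda>y. \<phi> y \<otimes> x) (carrier G) (carrier G)"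
proof -
  have "bij_betw (\<lambda>y. y \<otimes> x) (carrier G) (carrier G)"
    by (rule bij_betw_byWitness[where f' = "\<lambda>y. y \<otimes> inv x"]) (use x in \<open>auto simp: m_assoc\<close>)
  with \<phi> show ?thesis
    using bij_betw_trans[of \<phi> "carrier G" "carrier G" "\<lambda>y. y \<otimes> x" "carrier G"]
    by (simp add: iso_def o_def)
qed

text \<open>The affine map carries the cosets of a subgroup to those of its image under \<phi>, and
  as a bijection it preserves and reflects non-empty intersection. Hence \<phi> only has to fix or
  exchange \<open>H\<close> and \<open>K\<close>.\<close>

lemma graph_automorphism_Cos:
  assumes \<phi>: "\<phi> \<in> iso G G" and x: "x \<in> carrier G"
    and H: "subgroup H G" and K: "subgroup K G"
    and swap: "\<phi> ` H = H \<and> \<phi> ` K = K \<or> \<phi> ` H = K \<and> \<phi> ` K = H"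
  shows "graph_automorphism (Cos G H K) (image (\<lambda>y. \<phi> y \<otimes> x))"
proof -
  let ?\<sigma> = "\<lambda>y. \<phi> y \<otimes> x" and ?V = "pverts (Cos G H K)"
  have bij: "bij_betw ?\<sigma> (carrier G) (carrier G)" by (rule bij_betw_affine[OF \<phi> x])
  have rcosets: "(`) ?\<sigma> ` (rcosets L) = rcosets (\<phi> ` L)" if "subgroup L G" for L
  proof -
    have "(`) ?\<sigma> ` (rcosets L) = (\<lambda>g. (\<phi> ` L) #> g) ` ?\<sigma> ` carrier G"
      using image_rcos_affine[OF \<phi> subgroup.subset[OF that] _ x]
      by (simp add: RCOSETS_def UNION_singleton_eq_range image_image cong: image_cong)
    also have "\<dots> = rcosets (\<phi> ` L)" using bij by (simp add: bij_betw_def RCOSETS_def UNION_singleton_eq_range)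
    finally show ?thesis .
  qed
  have V: "?V = rcosets H \<union> rcosets K" by (simp add: Cos_def)
  have sub: "?V \<subseteq> Pow (carrier G)" using rcosets_subset_PowG H K by (auto simp: V)
  have inj: "inj_on ((`) ?\<sigma>) (Pow (carrier G))"
    using bij inj_on_image_Pow by (auto simp: bij_betw_def)
  have surj: "(`) ?\<sigma> ` ?V = ?V"
    using swap rcosets[OF H] rcosets[OF K] by (auto simp: V image_Un)
  have "(?\<sigma> ` A, ?\<sigma> ` B) \<in> parcs (Cos G H K) \<longleftrightarrow> (A, B) \<in> parcs (Cos G H K)"
    if A: "A \<in> ?V" and B: "B \<in> ?V" for A B
  proof -
    have "?\<sigma> ` A \<inter> ?\<sigma> ` B = ?\<sigma> ` (A \<inter> B)"
      using A B sub bij by (intro inj_on_image_Int[symmetric]) (auto simp: bij_betw_def)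
    \<comment> \<open>Injectivity on subsets of the carrier gives the reverse direction: a vertex
      whose image is a coset of the image of \<open>L\<close> was a coset of
      \<open>L\<close>.\<close>
    moreover have mem: "?\<sigma> ` C \<in> rcosets (\<phi> ` L) \<longleftrightarrow> C \<in> rcosets L"
      if C: "C \<in> ?V" and L: "subgroup L G" for C L
      using C sub inj_on_image_mem_iff[OF inj, of C "rcosets L"] rcosets_subset_PowG[OF L]
      by (auto simp: rcosets[OF L, symmetric])
    ultimately show ?thesis
      using swap mem[OF A H] mem[OF A K] mem[OF B H] mem[OF B K] by (auto simp: Cos_def)
  qed
  moreover have "bij_betw ((`) ?\<sigma>) ?V ?V"
    using inj_on_subset[OF inj sub] surj by (simp add: bij_betw_def)
  ultimately show ?thesis by (simp add: graph_automorphism_def)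
qed

section \<open>Neighbours, 3-arcs and 3-arc-transitivity\<close>

lemma Cos_neighbour_iff:
  assumes H: "subgroup H G" and K: "subgroup K G" and "H \<noteq> K" and x: "x \<in> carrier G"
  shows "(H #> x, B) \<in> parcs (Cos G H K) \<longleftrightarrow> (\<exists>h\<in>H. B = K #> (h \<otimes> x))"
proof
  assume "(H #> x, B) \<in> parcs (Cos G H K)"
  then obtain g where g: "g \<in> carrier G" "H #> x = H #> g \<and> B = K #> g \<or> H #> x = K #> g \<and> B = H #> g"
    using mem_parcs_Cos_iff[OF H K] by blast
  \<comment> \<open>This discards the alternative with the roles of \<open>H\<close> and
    \<open>K\<close> exchanged.\<close>
  moreover have "H #> x \<noteq> K #> g"
    using rcosets_common_imp_eq[OF H K] \<open>H \<noteq> K\<close> H K x g(1) by (metis rcosetsI subgroup.subset)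
  ultimately have "H #> x = H #> g" "B = K #> g" by auto
  then have "g \<otimes> inv x \<in> H" "B = K #> (g \<otimes> inv x \<otimes> x)"
    using rcos_eq_iff[OF H x g(1)] x g(1) by (auto simp: m_assoc)
  then show "\<exists>h\<in>H. B = K #> (h \<otimes> x)" by blast
next
  assume "\<exists>h\<in>H. B = K #> (h \<otimes> x)"
  then obtain h where h: "h \<in> H" "B = K #> (h \<otimes> x)" by blast
  then have hG: "h \<in> carrier G" using H by (rule_tac subgroup.mem_carrier)
  then have "H #> x = H #> (h \<otimes> x)"
    using h(1) x H by (simp add: rcos_eq_iff m_assoc)
  with h(2) hG x show "(H #> x, B) \<in> parcs (Cos G H K)"
    using mem_parcs_Cos_iff[OF H K] m_closed by blast
qed

lemma Cos_commute: "Cos G H K = Cos G K H"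
  by (auto simp: Cos_def)

lemma Cos_arc_sym: "(A, B) \<in> parcs (Cos G H K) \<longleftrightarrow> (B, A) \<in> parcs (Cos G H K)"
  by (auto simp: Cos_def)

text \<open>The middle arc supplies the common representative \<open>x\<close>, and its direction
  decides between the two forms. Each outer vertex is a neighbour of a middle one, reached by
  multiplying \<open>x\<close> by an element of \<open>H\<close> or \<open>K\<close>; since the arc
  does not backtrack, this element is not \<open>\<one>\<close>.\<close>

lemma s_arc_3_CosE:
  assumes H: "subgroup H G" and K: "subgroup K G" and "H \<noteq> K" and arc: "s_arc (Cos G H K) 3 vs"
  obtains x h k where "x \<in> carrier G" "h \<in> H - {\<one>}" "k \<in> K - {\<one>}"
      "vs = [K #> (h \<otimes> x), H #> x, K #> x, H #> (k \<otimes> x)] \<or>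
       vs = [H #> (k \<otimes> x), K #> x, H #> x, K #> (h \<otimes> x)]"
proof -
  obtain t u v w where vs: "vs = [t, u, v, w]" and "t \<noteq> v" "u \<noteq> w"
    and tu: "(t, u) \<in> parcs (Cos G H K)"
    and adj: "(u, v) \<in> parcs (Cos G H K)" "(v, w) \<in> parcs (Cos G H K)"
    using arc unfolding s_arc_3_iff by (elim exE conjE) (rule that)
  have ut: "(u, t) \<in> parcs (Cos G H K)" using tu Cos_arc_sym by blast
  obtain x where x: "x \<in> carrier G" "u = H #> x \<and> v = K #> x \<or> u = K #> x \<and> v = H #> x"
    using adj(1) mem_parcs_Cos_iff[OF H K] by blast
  have nH: "\<exists>h\<in>H. B = K #> (h \<otimes> x)" if "(H #> x, B) \<in> parcs (Cos G H K)" for B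
    using that Cos_neighbour_iff[OF H K \<open>H \<noteq> K\<close> x(1)] by blast
  have nK: "\<exists>k\<in>K. B = H #> (k \<otimes> x)" if "(K #> x, B) \<in> parcs (Cos G H K)" for B
    using that Cos_neighbour_iff[OF K H \<open>H \<noteq> K\<close>[symmetric] x(1)] unfolding Cos_commute[of H K] by blast
  from x(2) show thesis
  proof
    assume uv: "u = H #> x \<and> v = K #> x"
    then obtain h k where "h \<in> H" "t = K #> (h \<otimes> x)" "k \<in> K" "w = H #> (k \<otimes> x)"
      using ut adj(2) nH[of t] nK[of w] by blast
    moreover from this have "h \<noteq> \<one>" "k \<noteq> \<one>" using uv \<open>t \<noteq> v\<close> \<open>u \<noteq> w\<close> x(1) by auto
    ultimately show thesis using that x(1) uv vs by blast
  next
    assume uv: "u = K #> x \<and> v = H #> x"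
    then obtain h k where "h \<in> H" "w = K #> (h \<otimes> x)" "k \<in> K" "t = H #> (k \<otimes> x)"
      using ut adj(2) nH[of w] nK[of t] by blast
    moreover from this have "h \<noteq> \<one>" "k \<noteq> \<one>" using uv \<open>t \<noteq> v\<close> \<open>u \<noteq> w\<close> x(1) by auto
    ultimately show thesis using that x(1) uv vs by blast
  qed
qed

text \<open>Every 3-arc is the image of a base arc under an affine map: \<open>auts\<close> reaches
  the arcs that start at a \<open>K\<close>-coset, \<open>swaps\<close> those that start at an
  \<open>H\<close>-coset, and the translation supplies \<open>x\<close>.\<close>

theorem s_arc_transitive_Cos:
  assumes H: "subgroup H G" and K: "subgroup K G" and HK: "H \<inter> K = {\<one>}"
    and h0: "h0 \<in> H - {\<one>}" and k0: "k0 \<in> K - {\<one>}"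
    and auts: "\<And>h k. h \<in> H - {\<one>} \<Longrightarrow> k \<in> K - {\<one>} \<Longrightarrow>
      \<exists>\<phi>\<in>iso G G. \<phi> ` H = H \<and> \<phi> ` K = K \<and> \<phi> h0 = h \<and> \<phi> k0 = k"
    and swaps: "\<And>h k. h \<in> H - {\<one>} \<Longrightarrow> k \<in> K - {\<one>} \<Longrightarrow>
      \<exists>\<phi>\<in>iso G G. \<phi> ` H = K \<and> \<phi> ` K = H \<and> \<phi> h0 = k \<and> \<phi> k0 = h"
  shows "s_arc_transitive (Cos G H K) 3"
proof -
  have "H \<noteq> K" using HK h0 by blast
  have sub: "H \<subseteq> carrier G" "K \<subseteq> carrier G" using H K subgroup.subset by auto
  have h0G: "h0 \<in> carrier G" and k0G: "k0 \<in> carrier G" using h0 k0 sub by auto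
  \<comment> \<open>The first form of \<open>s_arc_3_CosE\<close> at \<open>x = \<one>\<close>,
    centred on the edge between \<open>H\<close> and \<open>K\<close> themselves.\<close>
  let ?us = "[K #> h0, H #> \<one>, K #> \<one>, H #> k0]"
  show ?thesis
  proof (rule s_arc_transitiveI)
    have "(H #> \<one>, K #> h0) \<in> parcs (Cos G H K)" "(H #> \<one>, K #> \<one>) \<in> parcs (Cos G H K)"
      using Cos_neighbour_iff[OF H K \<open>H \<noteq> K\<close> one_closed] h0 h0G subgroup.one_closed[OF H]
      by (metis DiffD1 r_one one_closed)+
    moreover have "(K #> \<one>, H #> k0) \<in> parcs (Cos G H K)"
      using Cos_neighbour_iff[OF K H \<open>H \<noteq> K\<close>[symmetric] one_closed] k0 k0G Cos_commute
      by (metis DiffD1 r_one)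
    \<comment> \<open>Equality would put \<open>h0\<close> into \<open>K\<close>, respectively
      \<open>k0\<close> into \<open>H\<close>, against the trivial intersection.\<close>
    moreover have "K #> h0 \<noteq> K #> \<one>" "H #> \<one> \<noteq> H #> k0"
      using HK h0 k0 rcos_self[OF h0G K] rcos_self[OF k0G H] sub by auto
    moreover have "{K #> h0, H #> \<one>, K #> \<one>, H #> k0} \<subseteq> pverts (Cos G H K)"
      using rcosetsI[OF sub(1) one_closed] rcosetsI[OF sub(2) one_closed]
        rcosetsI[OF sub(1) k0G] rcosetsI[OF sub(2) h0G] by (simp add: Cos_def)
    ultimately show "s_arc (Cos G H K) 3 ?us"
      unfolding s_arc_3_iff using Cos_arc_sym[of "K #> h0" "H #> \<one>"] by simp
    fix vs assume "s_arc (Cos G H K) 3 vs"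
    then obtain x h k where x: "x \<in> carrier G" and h: "h \<in> H - {\<one>}" and k: "k \<in> K - {\<one>}"
      and vs: "vs = [K #> (h \<otimes> x), H #> x, K #> x, H #> (k \<otimes> x)] \<or>
       vs = [H #> (k \<otimes> x), K #> x, H #> x, K #> (h \<otimes> x)]"
      by (rule s_arc_3_CosE[OF H K \<open>H \<noteq> K\<close>])
    have map_us: "map (image (\<lambda>y. \<phi> y \<otimes> x)) ?us = [(\<phi> ` K) #> (\<phi> h0 \<otimes> x), (\<phi> ` H) #> x,
        (\<phi> ` K) #> x, (\<phi> ` H) #> (\<phi> k0 \<otimes> x)]" if "\<phi> \<in> iso G G" for \<phi>
    proof -
      have "\<phi> \<one> = \<one>" using that is_group hom_one by (auto simp: iso_def)
      then show ?thesis
        using that h0G k0G x image_rcos_affine[OF that sub(1) _ x] image_rcos_affine[OF that sub(2) _ x]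
        by simp
    qed
    from vs show "\<exists>f. graph_automorphism (Cos G H K) f \<and> map f ?us = vs"
    proof
      assume vs: "vs = [K #> (h \<otimes> x), H #> x, K #> x, H #> (k \<otimes> x)]"
      obtain \<phi> where "\<phi> \<in> iso G G" "\<phi> ` H = H" "\<phi> ` K = K" "\<phi> h0 = h" "\<phi> k0 = k"
        using auts[OF h k] by blast
      with vs show ?thesis
        using graph_automorphism_Cos[of \<phi> x H K] map_us[of \<phi>] x H K
        by (intro exI[of _ "image (\<lambda>y. \<phi> y \<otimes> x)"]) simp
    next
      assume vs: "vs = [H #> (k \<otimes> x), K #> x, H #> x, K #> (h \<otimes> x)]"
      obtain \<phi> where "\<phi> \<in> iso G G" "\<phi> ` H = K" "\<phi> ` K = H" "\<phi> h0 = k" "\<phi> k0 = h"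
        using swaps[OF h k] by blast
      with vs show ?thesis
        using graph_automorphism_Cos[of \<phi> x H K] map_us[of \<phi>] x H K
        by (intro exI[of _ "image (\<lambda>y. \<phi> y \<otimes> x)"]) simp
    qed
  qed
qed

end

section \<open>The group presentation\<close>

definition word_val :: "('a, 'm) monoid_scheme \<Rightarrow> ('g \<Rightarrow> 'a) \<Rightarrow> 'g word \<Rightarrow> 'a" where
  "word_val G f w = foldr (\<lambda>(x, e) y. (if e then f x else inv\<^bsub>G\<^esub> f x) \<otimes>\<^bsub>G\<^esub> y) w \<one>\<^bsub>G\<^esub>"

lemma word_val_Nil: "word_val G f [] = \<one>\<^bsub>G\<^esub>"
  by (simp add: word_val_def)

lemma word_val_Cons:
  "word_val G f ((x, e) # w) = (if e then f x else inv\<^bsub>G\<^esub> f x) \<otimes>\<^bsub>G\<^esub> word_val G f w"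
  by (simp add: word_val_def)

context group
begin

lemma word_val_closed:
  assumes "range f \<subseteq> carrier G"
  shows "word_val G f w \<in> carrier G"
  by (induction w) (use assms in \<open>auto simp: word_val_Nil word_val_Cons range_subsetD\<close>)

lemma word_val_append:
  assumes f: "range f \<subseteq> carrier G"
  shows "word_val G f (u @ v) = word_val G f u \<otimes> word_val G f v"
  by (induction u)
    (use f word_val_closed[OF f] in \<open>auto simp: word_val_Nil word_val_Cons m_assoc range_subsetD\<close>)

lemma word_val_replicate:
  assumes "range f \<subseteq> carrier G"
  shows "word_val G f (replicate n (x, True)) = f x [^] n"
  by (induction n) (use assms nat_pow_Suc2 in \<open>auto simp: word_val_Nil word_val_Cons range_subsetD\<close>)

text \<open>Having equal values is itself a congruence that contains \<open>R\<close> and free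
  cancellation, so it contains the least one.\<close>

lemma word_val_pres_eq:
  assumes f: "range f \<subseteq> carrier G"
    and rel: "\<And>u v. (u, v) \<in> R \<Longrightarrow> word_val G f u = word_val G f v"
    and "pres_eq R u v"
  shows "word_val G f u = word_val G f v"
  using assms(3)
  by induction
    (use f rel in \<open>auto simp: word_val_Nil word_val_Cons word_val_append range_subsetD\<close>)

text \<open>Von Dyck's theorem: evaluation is constant on each class and therefore descends to the
  quotient.\<close>

lemma presented_group_lift:
  assumes f: "range f \<subseteq> carrier G"
    and rel: "\<And>u v. (u, v) \<in> R \<Longrightarrow> word_val G f u = word_val G f v"
  obtains \<phi> where "\<phi> \<in> hom (presented_group R) G" "\<And>x. \<phi> (pres_gen R x) = f x"
proof -
  \<comment> \<open>All words of a class share one value, which \<open>the_elem\<close>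
    extracts.\<close>
  define \<phi> where "\<phi> A = the_elem (word_val G f ` A)" for A
  have \<phi>: "\<phi> (pres_class R w) = word_val G f w" for w
  proof -
    have "word_val G f ` pres_class R w = {word_val G f w}"
      using word_val_pres_eq[OF f rel] by (auto simp: pres_class_def intro!: image_eqI pres_eq.refl)
    then show ?thesis by (simp add: \<phi>_def)
  qed
  have "\<phi> \<in> hom (presented_group R) G"
  proof (rule homI)
    fix A B assume "A \<in> carrier (presented_group R)" "B \<in> carrier (presented_group R)"
    then obtain u v where uv: "A = pres_class R u" "B = pres_class R v"
      by (auto simp: presented_group_def)
    show "\<phi> A \<in> carrier G" using uv word_val_closed[OF f] by (simp add: \<phi>)
    show "\<phi> (A \<otimes>\<^bsub>presented_group R\<^esub> B) = \<phi> A \<otimes> \<phi> B"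
      using uv word_val_append[OF f] by (simp add: \<phi> presented_group_mult)
  qed
  moreover have "\<phi> (pres_gen R x) = f x" for x
    using f by (simp add: pres_gen_def \<phi> word_val_Nil word_val_Cons range_subsetD)
  ultimately show thesis by (rule that)
qed

text \<open>Clearing inverses turns \<open>[x, y] = z\<close> into the rewriting rule
  \<open>x y = y x z\<close>. The equivalence is read in one direction to obtain the relations of
  the presented group and in the other to check them in the target of a lift.\<close>

lemma extraspecial_relations_iff:
  assumes f: "range f \<subseteq> carrier G"
  shows "(\<forall>(u, v)\<in>extraspecial_relations p. word_val G f u = word_val G f v) \<longleftrightarrow>
    (\<forall>x. f x [^] p = \<one>) \<and> f Gen_a \<otimes> f Gen_b = f Gen_b \<otimes> (f Gen_a \<otimes> f Gen_c) \<and>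
    f Gen_c \<otimes> f Gen_a = f Gen_a \<otimes> f Gen_c \<and> f Gen_c \<otimes> f Gen_b = f Gen_b \<otimes> f Gen_c"
proof -
  have fG: "f x \<in> carrier G" for x using f by auto
  have all: "(\<forall>x. Q x) \<longleftrightarrow> Q Gen_a \<and> Q Gen_b \<and> Q Gen_c" for Q by (metis gen.exhaust)
  have comm: "word_val G f (word_commutator [(x, True)] [(y, True)]) = z \<longleftrightarrow> f x \<otimes> f y = f y \<otimes> (f x \<otimes> z)"
    if "z \<in> carrier G" for x y z
  proof -
    have "word_val G f (word_commutator [(x, True)] [(y, True)]) = inv (f x) \<otimes> (inv (f y) \<otimes> (f x \<otimes> f y))"
      using fG by (simp add: word_commutator_def word_inv_def word_val_Nil word_val_Cons)
    also have "\<dots> = z \<longleftrightarrow> inv (f y) \<otimes> (f x \<otimes> f y) = f x \<otimes> z"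
      using fG that inv_solve_left' by (metis inv_closed m_closed)
    also have "\<dots> \<longleftrightarrow> f x \<otimes> f y = f y \<otimes> (f x \<otimes> z)"
      using fG that inv_solve_left' by (metis inv_closed m_closed)
    finally show ?thesis .
  qed
  show ?thesis
    unfolding extraspecial_relations_def Let_def all
    using fG comm[OF fG] comm[OF one_closed]
    by (simp add: word_val_replicate[OF f] word_val_Nil word_val_Cons)
qed

section \<open>Powers of two elements with central commutator\<close>

lemma commute_pow_right:
  assumes "x \<in> carrier G" "y \<in> carrier G" "z \<in> carrier G"
    and xy: "x \<otimes> y = y \<otimes> (x \<otimes> z)" and zy: "z \<otimes> y = y \<otimes> z"
  shows "x \<otimes> y [^] (j::nat) = y [^] j \<otimes> (x \<otimes> z [^] j)"
proof (induction j)
  case (Suc j)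
  have "x \<otimes> y [^] Suc j = (x \<otimes> y [^] j) \<otimes> y" using assms by (simp add: m_assoc)
  also have "\<dots> = y [^] j \<otimes> (x \<otimes> (z [^] j \<otimes> y))" using Suc assms by (simp add: m_assoc)
  also have "z [^] j \<otimes> y = y \<otimes> z [^] j" using group_commutes_pow[OF zy] assms by simp
  also have "y [^] j \<otimes> (x \<otimes> (y \<otimes> z [^] j)) = y [^] j \<otimes> ((x \<otimes> y) \<otimes> z [^] j)"
    using assms(1-3) by (simp add: m_assoc)
  also have "\<dots> = y [^] Suc j \<otimes> (x \<otimes> (z \<otimes> z [^] j))" unfolding xy using assms by (simp add: m_assoc)
  finally show ?case using assms nat_pow_Suc2[of z j] by simp
qed (use assms in simp)

lemma commute_pow_left:
  assumes "x \<in> carrier G" "y \<in> carrier G" "z \<in> carrier G"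
    and xy: "x \<otimes> y = y \<otimes> (x \<otimes> z)" and zx: "z \<otimes> x = x \<otimes> z"
  shows "x [^] (i::nat) \<otimes> y = y \<otimes> (x [^] i \<otimes> z [^] i)"
proof (induction i)
  case (Suc i)
  have "x [^] Suc i \<otimes> y = x [^] i \<otimes> (x \<otimes> y)" using assms by (simp add: m_assoc)
  also have "\<dots> = (x [^] i \<otimes> y) \<otimes> (x \<otimes> z)" unfolding xy using assms by (simp add: m_assoc)
  also have "\<dots> = y \<otimes> (x [^] i \<otimes> ((z [^] i \<otimes> x) \<otimes> z))" using Suc assms by (simp add: m_assoc)
  also have "z [^] i \<otimes> x = x \<otimes> z [^] i" using group_commutes_pow[OF zx] assms by simp
  finally show ?case using assms by (simp add: m_assoc)
qed (use assms in simp)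

text \<open>Bilinearity of the commutator: the left rule gives \<open>z [^] i\<close> for
  \<open>x [^] i\<close> and \<open>y\<close>, and the right rule is then applied with
  \<open>z [^] i\<close> as the commutator.\<close>

lemma commute_pow_pow:
  assumes "x \<in> carrier G" "y \<in> carrier G" "z \<in> carrier G"
    and xy: "x \<otimes> y = y \<otimes> (x \<otimes> z)" and zx: "z \<otimes> x = x \<otimes> z" and zy: "z \<otimes> y = y \<otimes> z"
  shows "x [^] (i::nat) \<otimes> y [^] (j::nat) = y [^] j \<otimes> (x [^] i \<otimes> z [^] (i * j))"
proof -
  have "z [^] i \<otimes> y = y \<otimes> z [^] i" using group_commutes_pow[OF zy] assms by simp
  then show ?thesis
    using commute_pow_right[OF _ _ _ commute_pow_left[OF assms(1-3) xy zx]] assms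
    by (simp add: nat_pow_pow)
qed

end

text \<open>This makes every element of the presented group a word in the generators, and turns each
  defining relation into an equation of values.\<close>

lemma presented_group_word_val:
  "word_val (presented_group R) (pres_gen R) w = pres_class R w"
proof (induction w)
  case Nil
  show ?case by (simp add: word_val_Nil presented_group_def)
next
  case (Cons l w)
  interpret group "presented_group R" by (rule group_presented_group)
  obtain x e where l: "l = (x, e)" by (cases l)
  have car: "pres_class R v \<in> carrier (presented_group R)" for v by (simp add: presented_group_def)
  have "pres_class R [(x, False)] \<otimes>\<^bsub>presented_group R\<^esub> pres_gen R x = \<one>\<^bsub>presented_group R\<^esub>"
    using pres_eq.cancel[of R x False]
    by (simp add: pres_gen_def presented_group_mult pres_class_eq_iff) (simp add: presented_group_def pres_class_eq_iff)
  then have "inv\<^bsub>presented_group R\<^esub> (pres_gen R x) = pres_class R [(x, False)]"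
    using car inv_equality by (auto simp: pres_gen_def)
  then have "(if e then pres_gen R x else inv\<^bsub>presented_group R\<^esub> pres_gen R x) = pres_class R [l]"
    by (simp add: l pres_gen_def)
  then show ?case
    using Cons presented_group_mult[of R "[l]" w] by (simp add: l word_val_Cons)
qed

section \<open>The presented group: relations, lifts and normal form\<close>

locale extraspecial_group =
  fixes p :: nat and G (structure) and a b c
  assumes p: "prime p"
    and G_def: "G = presented_group (extraspecial_relations p)"
    and a_def: "a = pres_gen (extraspecial_relations p) Gen_a"
    and b_def: "b = pres_gen (extraspecial_relations p) Gen_b"
    and c_def: "c = pres_gen (extraspecial_relations p) Gen_c"
begin

sublocale group G
  unfolding G_def by (rule group_presented_group)

abbreviation gens :: "gen \<Rightarrow> gen word set" where
  "gens \<equiv> pres_gen (extraspecial_relations p)"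

lemma range_gens: "range gens \<subseteq> carrier G"
  by (auto simp: G_def pres_gen_def presented_group_def)

lemma gens_closed [simp]: "a \<in> carrier G" "b \<in> carrier G" "c \<in> carrier G"
  using range_gens by (auto simp: a_def b_def c_def)

lemma relations:
  "a [^] p = \<one>" "b [^] p = \<one>" "c [^] p = \<one>"
  "a \<otimes> b = b \<otimes> (a \<otimes> c)" "c \<otimes> a = a \<otimes> c" "c \<otimes> b = b \<otimes> c"
proof -
  have "\<forall>(u, v)\<in>extraspecial_relations p. word_val G gens u = word_val G gens v"
    by (auto simp: G_def presented_group_word_val pres_class_eq_iff intro: pres_eq.rel)
  then show "a [^] p = \<one>" "b [^] p = \<one>" "c [^] p = \<one>"
      "a \<otimes> b = b \<otimes> (a \<otimes> c)" "c \<otimes> a = a \<otimes> c" "c \<otimes> b = b \<otimes> c"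
    unfolding extraspecial_relations_iff[OF range_gens] by (simp_all add: a_def b_def c_def)
qed

text \<open>The image \<open>w\<close> of \<open>c\<close> does not appear in the conclusion; as
  \<open>c\<close> is the commutator of \<open>a\<close> and \<open>b\<close>, it is determined by
  \<open>u\<close> and \<open>v\<close>.\<close>

lemma lift:
  assumes "group H" and uvw: "u \<in> carrier H" "v \<in> carrier H" "w \<in> carrier H"
    and "u [^]\<^bsub>H\<^esub> p = \<one>\<^bsub>H\<^esub>" "v [^]\<^bsub>H\<^esub> p = \<one>\<^bsub>H\<^esub>" "w [^]\<^bsub>H\<^esub> p = \<one>\<^bsub>H\<^esub>"
    and "u \<otimes>\<^bsub>H\<^esub> v = v \<otimes>\<^bsub>H\<^esub> (u \<otimes>\<^bsub>H\<^esub> w)" "w \<otimes>\<^bsub>H\<^esub> u = u \<otimes>\<^bsub>H\<^esub> w" "w \<otimes>\<^bsub>H\<^esub> v = v \<otimes>\<^bsub>H\<^esub> w"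
  obtains \<phi> where "\<phi> \<in> hom G H" "\<phi> a = u" "\<phi> b = v"
proof -
  interpret H: group H by fact
  define f where "f = case_gen u v w"
  have f: "range f \<subseteq> carrier H" using uvw by (auto simp: f_def split: gen.split)
  have "\<forall>x. f x [^]\<^bsub>H\<^esub> p = \<one>\<^bsub>H\<^esub>" using assms by (auto simp: f_def split: gen.split)
  then have "\<forall>(u, v)\<in>extraspecial_relations p. word_val H f u = word_val H f v"
    unfolding H.extraspecial_relations_iff[OF f] using assms by (simp add: f_def)
  then obtain \<phi> where "\<phi> \<in> hom G H" "\<And>x. \<phi> (gens x) = f x"
    using H.presented_group_lift[OF f, of "extraspecial_relations p"] unfolding G_def by blast
  then show thesis using that by (simp add: f_def a_def b_def)
qed

text \<open>The two coordinate homomorphisms to the integers modulo \<open>p\<close> separate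
  \<open>a\<close> from \<open>b\<close>: \<alpha> sends \<open>a\<close> to 1 and \<open>b\<close>
  to 0, \<beta> does the reverse. The target is abelian, so the relations hold there with
  \<open>c\<close> sent to 0.\<close>

lemma exponents_mod_p:
  assumes "a [^] (i::nat) = b [^] (j::nat)"
  shows "p dvd i" "p dvd j"
proof -
  let ?Z = "integer_mod_group p"
  have "1 < p" using p by (rule prime_gt_1_nat)
  then have car: "0 \<in> carrier ?Z" "1 \<in> carrier ?Z" by (auto simp: carrier_integer_mod_group)
  have pow: "1 [^]\<^bsub>?Z\<^esub> k = int k mod int p" "0 [^]\<^bsub>?Z\<^esub> k = 0" for k :: nat
    by (simp_all add: pow_integer_mod_group)
  obtain \<alpha> where \<alpha>: "\<alpha> \<in> hom G ?Z" "\<alpha> a = 1" "\<alpha> b = 0"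
    by (rule lift[of ?Z 1 0 0]) (use car pow in \<open>auto simp: mult_integer_mod_group\<close>)
  obtain \<beta> where \<beta>: "\<beta> \<in> hom G ?Z" "\<beta> a = 0" "\<beta> b = 1"
    by (rule lift[of ?Z 0 1 0]) (use car pow in \<open>auto simp: mult_integer_mod_group\<close>)
  have hom_pow: "\<gamma> (x [^] k) = \<gamma> x [^]\<^bsub>?Z\<^esub> k" if "\<gamma> \<in> hom G ?Z" "x \<in> carrier G" for \<gamma> x and k :: nat
    using hom_nat_pow[OF that(1) that(2)] is_group by simp
  have "int i mod int p = 0" using arg_cong[OF assms, of \<alpha>] \<alpha> pow by (simp add: hom_pow)
  then show "p dvd i" by (simp add: mod_eq_0_iff_dvd)
  have "int j mod int p = 0" using arg_cong[OF assms, of \<beta>] \<beta> pow by (simp add: hom_pow)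
  then show "p dvd j" by (simp add: mod_eq_0_iff_dvd)
qed

lemma pow_mod_p:
  assumes "x \<in> carrier G" "x [^] p = \<one>"
  shows "x [^] (n mod p) = x [^] n"
proof -
  have "x [^] n = x [^] (p * (n div p) + n mod p)" by simp
  also have "\<dots> = (x [^] p) [^] (n div p) \<otimes> x [^] (n mod p)"
    using assms(1) by (simp only: nat_pow_mult nat_pow_pow)
  finally show ?thesis using assms by simp
qed

text \<open>The set \<open>?N\<close> of normal forms is closed under left multiplication by the
  generators, hence by their powers and inverses, so it contains the value of every word.\<close>

lemma normal_form:
  assumes "g \<in> carrier G"
  shows "\<exists>(i :: nat) (j :: nat) (k :: nat). g = b [^] j \<otimes> (a [^] i \<otimes> c [^] k)"
proof -
  let ?N = "{b [^] j \<otimes> (a [^] i \<otimes> c [^] k) | (i :: nat) (j :: nat) (k :: nat). True}"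
  have N: "?N \<subseteq> carrier G" by auto
  have c_comm: "c \<otimes> a [^] i = a [^] i \<otimes> c" "c \<otimes> b [^] i = b [^] i \<otimes> c" for i :: nat
    using group_commutes_pow[OF relations(5)[symmetric], of i] group_commutes_pow[OF relations(6)[symmetric], of i] by simp_all
  have a: "a \<otimes> n \<in> ?N" if nN: "n \<in> ?N" for n
  proof -
    obtain i j k :: nat where n: "n = b [^] j \<otimes> (a [^] i \<otimes> c [^] k)" using nN by blast
    have "a \<otimes> n = (a \<otimes> b [^] j) \<otimes> (a [^] i \<otimes> c [^] k)" by (simp add: n m_assoc)
    \<comment> \<open>Moving \<open>a\<close> past \<open>b [^] j\<close> creates
      \<open>c [^] j\<close>, which commutes with \<open>a\<close> and is collected at the right
      end.\<close>
    also have "\<dots> = b [^] j \<otimes> (a \<otimes> (c [^] j \<otimes> a [^] i) \<otimes> c [^] k)"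
      using commute_pow_right[OF _ _ _ relations(4,6)] by (simp add: m_assoc)
    also have "c [^] j \<otimes> a [^] i = a [^] i \<otimes> c [^] j"
      using group_commutes_pow[OF c_comm(1)] by simp
    also have "a \<otimes> (a [^] i \<otimes> c [^] j) \<otimes> c [^] k = (a \<otimes> a [^] i) \<otimes> (c [^] j \<otimes> c [^] k)"
      by (simp add: m_assoc)
    also have "\<dots> = a [^] Suc i \<otimes> c [^] (j + k)"
      by (simp only: nat_pow_Suc2[OF gens_closed(1)] nat_pow_mult[OF gens_closed(3)])
    finally show ?thesis by blast
  qed
  have b: "b \<otimes> n \<in> ?N" if nN: "n \<in> ?N" for n
  proof -
    obtain i j k :: nat where n: "n = b [^] j \<otimes> (a [^] i \<otimes> c [^] k)" using nN by blast
    have "b \<otimes> n = (b \<otimes> b [^] j) \<otimes> (a [^] i \<otimes> c [^] k)" by (simp add: n m_assoc)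
    also have "\<dots> = b [^] Suc j \<otimes> (a [^] i \<otimes> c [^] k)"
      by (simp only: nat_pow_Suc2[OF gens_closed(2)])
    finally show ?thesis by blast
  qed
  have c: "c \<otimes> n \<in> ?N" if nN: "n \<in> ?N" for n
  proof -
    obtain i j k :: nat where n: "n = b [^] j \<otimes> (a [^] i \<otimes> c [^] k)" using nN by blast
    have "c \<otimes> n = (c \<otimes> b [^] j) \<otimes> (a [^] i \<otimes> c [^] k)" by (simp add: n m_assoc)
    also have "\<dots> = b [^] j \<otimes> ((c \<otimes> a [^] i) \<otimes> c [^] k)"
      unfolding c_comm(2) by (simp add: m_assoc)
    also have "\<dots> = b [^] j \<otimes> (a [^] i \<otimes> (c \<otimes> c [^] k))"
      unfolding c_comm(1) by (simp add: m_assoc)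
    also have "\<dots> = b [^] j \<otimes> (a [^] i \<otimes> c [^] Suc k)"
      by (simp only: nat_pow_Suc2[OF gens_closed(3)])
    finally show ?thesis by blast
  qed
  have gens: "gens x \<otimes> n \<in> ?N" if "n \<in> ?N" for x n
    using a b c that by (cases x) (simp_all add: a_def b_def c_def)
  have gens_pow: "gens x [^] (m::nat) \<otimes> n \<in> ?N" if "n \<in> ?N" for x m n
    using that
  proof (induction m arbitrary: n)
    case 0
    then have "n \<in> carrier G" using N by (rule rev_subsetD)
    then show ?case using 0 by (simp only: nat_pow_0 l_one)
  next
    case (Suc m)
    have "gens x [^] Suc m \<otimes> n = gens x [^] m \<otimes> (gens x \<otimes> n)"
      using range_gens N Suc.prems by (auto simp: m_assoc range_subsetD)
    then show ?case using Suc.IH[OF gens[OF Suc.prems]] by simp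
  qed
  \<comment> \<open>Since every generator has trivial \<open>p\<close>-th power, inverse letters can
    be treated as positive powers.\<close>
  have "inv (gens x) = gens x [^] (p - 1)" for x
  proof (rule inv_equality)
    have x: "gens x \<in> carrier G" using range_gens by auto
    then show "gens x \<in> carrier G" "gens x [^] (p - 1) \<in> carrier G" by auto
    have "gens x [^] p = \<one>" using relations(1-3) by (cases x) (simp_all add: a_def b_def c_def)
    then show "gens x [^] (p - 1) \<otimes> gens x = \<one>"
      using nat_pow_Suc[of "gens x" "p - 1"] prime_gt_0_nat[OF p] by simp
  qed
  then have "word_val G gens w \<in> ?N" for w
  proof (induction w)
    case Nil
    have "\<one> = b [^] (0::nat) \<otimes> (a [^] (0::nat) \<otimes> c [^] (0::nat))" by simp
    then show ?case unfolding word_val_Nil by blast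
  next
    case (Cons l w)
    obtain x e where l: "l = (x, e)" by (cases l)
    show ?case unfolding l word_val_Cons
      using gens[OF Cons.IH[OF Cons.prems]] gens_pow[OF Cons.IH[OF Cons.prems]] Cons.prems by simp
  qed
  moreover obtain w where "g = word_val G gens w"
    using assms by (auto simp: G_def presented_group_word_val) (auto simp: presented_group_def)
  ultimately show ?thesis by blast
qed

section \<open>Finiteness and bijective endomorphisms\<close>

lemma finite_carrier: "finite (carrier G)"
proof (rule finite_subset)
  show "carrier G \<subseteq> (\<lambda>(i, j, k). b [^] j \<otimes> (a [^] i \<otimes> c [^] k)) ` ({..<p} \<times> {..<p} \<times> {..<p})"
  proof
    fix g assume "g \<in> carrier G"
    then obtain i j k :: nat where "g = b [^] j \<otimes> (a [^] i \<otimes> c [^] k)" using normal_form by blast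
    then have "g = b [^] (j mod p) \<otimes> (a [^] (i mod p) \<otimes> c [^] (k mod p))"
      by (simp add: pow_mod_p relations)
    then show "g \<in> (\<lambda>(i, j, k). b [^] j \<otimes> (a [^] i \<otimes> c [^] k)) ` ({..<p} \<times> {..<p} \<times> {..<p})"
      using prime_gt_0_nat[OF p]
      by (intro image_eqI[of _ _ "(i mod p, j mod p, k mod p)"]) simp_all
  qed
qed simp

text \<open>The image is a subgroup that contains \<open>a\<close> and \<open>b\<close>, hence also
  their commutator \<open>c\<close> and every normal form. A surjective self-map of a finite set is
  injective.\<close>

lemma endomorphism_iso:
  assumes \<phi>: "\<phi> \<in> hom G G" and a: "a \<in> \<phi> ` carrier G" and b: "b \<in> \<phi> ` carrier G"
  shows "\<phi> \<in> iso G G"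
proof -
  interpret \<phi>: group_hom G G \<phi> by unfold_locales (rule \<phi>)
  have S: "subgroup (\<phi> ` carrier G) G" by (rule \<phi>.img_is_subgroup)
  have "c = inv a \<otimes> (inv b \<otimes> (a \<otimes> b))" by (simp add: relations(4) m_assoc[symmetric])
  then have c: "c \<in> \<phi> ` carrier G"
    using a b S by (simp add: subgroup.m_closed subgroup.m_inv_closed)
  have pow: "x [^] (n::nat) \<in> \<phi> ` carrier G" if "x \<in> \<phi> ` carrier G" for x n
    using that S by (induction n) (simp_all add: subgroup.one_closed subgroup.m_closed)
  have "carrier G \<subseteq> \<phi> ` carrier G"
  proof
    fix g assume "g \<in> carrier G"
    then obtain i j k :: nat where "g = b [^] j \<otimes> (a [^] i \<otimes> c [^] k)" using normal_form by blast
    then show "g \<in> \<phi> ` carrier G"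
      using pow[OF a] pow[OF b] pow[OF c] S by (simp add: subgroup.m_closed)
  qed
  then have "\<phi> ` carrier G = carrier G" using \<phi>.hom_closed by blast
  moreover from this have "inj_on \<phi> (carrier G)" by (intro eq_card_imp_inj_on finite_carrier) simp
  ultimately show ?thesis using \<phi> by (simp add: iso_def bij_betw_def)
qed

section \<open>The cyclic subgroups generated by elements with trivial \<open>p\<close>-th
  power\<close>

lemma generate_eq_powers:
  assumes "x \<in> carrier G"
  shows "generate G {x} = {x [^] (k::nat) | k. True}"
  using generate_pow_on_finite_carrier[OF finite_carrier assms] by simp

text \<open>Links the powers listed in the connection set to subgroups: exponents matter only modulo
  \<open>p\<close>, and \<open>dvd\<close> makes the non-zero residues give non-trivial
  elements.\<close>

lemma nontrivial_powers:
  assumes x: "x \<in> carrier G" "x [^] p = \<one>" and dvd: "\<And>k::nat. x [^] k = \<one> \<Longrightarrow> p dvd k"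
  shows "generate G {x} - {\<one>} = {x [^] k | k. k \<in> {1..p - 1}}"
proof
  show "generate G {x} - {\<one>} \<subseteq> {x [^] k | k. k \<in> {1..p - 1}}"
  proof
    fix y assume y: "y \<in> generate G {x} - {\<one>}"
    then obtain k :: nat where "y = x [^] k" using generate_eq_powers[OF x(1)] by blast
    then have k: "y = x [^] (k mod p)" using pow_mod_p[OF x] by simp
    with y have "k mod p \<noteq> 0" by (metis DiffE insertI1 nat_pow_0)
    then have "k mod p \<in> {1..p - 1}"
      using mod_less_divisor[of p k] prime_gt_0_nat[OF p] by (simp add: Suc_le_eq less_eq_Suc_le[symmetric] del: mod_less_divisor)
    with k show "y \<in> {x [^] k | k. k \<in> {1..p - 1}}" by blast
  qed
  show "{x [^] k | k. k \<in> {1..p - 1}} \<subseteq> generate G {x} - {\<one>}"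
  proof
    fix y assume "y \<in> {x [^] k | k. k \<in> {1..p - 1}}"
    then obtain k where k: "y = x [^] k" "0 < k" "k < p" by force
    then have "y \<noteq> \<one>" using dvd[of k] dvd_imp_le[of p k] by auto
    then show "y \<in> generate G {x} - {\<one>}" using k(1) generate_eq_powers[OF x(1)] by blast
  qed
qed

text \<open>\<open>m\<close> is an inverse of \<open>k\<close> modulo the prime
  \<open>p\<close>.\<close>

lemma power_generates:
  assumes x: "x \<in> carrier G" "x [^] p = \<one>" and k: "k \<in> {1..p - 1}"
  obtains m :: nat where "(x [^] k) [^] m = x"
proof -
  have "\<not> p dvd k" using k dvd_imp_le[of p k] by auto
  then have "coprime k p" using prime_imp_coprime[OF p] by (simp add: coprime_commute)
  then obtain m where "[k * m = Suc 0] (mod p)" using cong_solve_coprime_nat by blast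
  then have "x [^] (k * m) = x [^] Suc 0" using pow_mod_p[OF x] by (metis cong_def)
  then show thesis using that x(1) by (simp add: nat_pow_pow)
qed

lemma generate_power:
  assumes x: "x \<in> carrier G" "x [^] p = \<one>" and k: "k \<in> {1..p - 1}"
  shows "generate G {x [^] k} = generate G {x}"
proof
  have car: "{x} \<subseteq> carrier G" "{x [^] k} \<subseteq> carrier G" using x by auto
  obtain m :: nat where m: "(x [^] k) [^] m = x" using power_generates[OF x k] .
  have "{x} \<subseteq> generate G {x [^] k}"
    unfolding generate_eq_powers[OF nat_pow_closed[OF x(1)]] using m[symmetric] by blast
  then show "generate G {x} \<subseteq> generate G {x [^] k}"
    by (rule generate_subgroup_incl) (rule generate_is_subgroup[OF car(2)])
  have "{x [^] k} \<subseteq> generate G {x}" using generate_eq_powers[OF x(1)] by blast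
  then show "generate G {x [^] k} \<subseteq> generate G {x}"
    by (rule generate_subgroup_incl) (rule generate_is_subgroup[OF car(1)])
qed

section \<open>Automorphisms with prescribed values on the generators\<close>

lemma pow_pow_eq_one:
  assumes "x \<in> carrier G" "x [^] p = \<one>"
  shows "(x [^] (n::nat)) [^] p = \<one>"
  using assms by (metis mult.commute nat_pow_one nat_pow_pow)

text \<open>The triple \<open>(x, y, z)\<close> is \<open>(a, b, c)\<close> or \<open>(b, a, c\<inverse>)\<close>: the defining relations are
  preserved by exchanging \<open>a\<close> and \<open>b\<close> while inverting \<open>c\<close>.\<close>

lemma automorphism_exists:
  assumes xyz: "x \<in> carrier G" "y \<in> carrier G" "z \<in> carrier G" "{x, y} = {a, b}"
    and z: "z [^] p = \<one>" and xy: "x \<otimes> y = y \<otimes> (x \<otimes> z)"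
    and zx: "z \<otimes> x = x \<otimes> z" and zy: "z \<otimes> y = y \<otimes> z"
    and u: "u \<in> generate G {x} - {\<one>}" and v: "v \<in> generate G {y} - {\<one>}"
  obtains \<phi> where "\<phi> \<in> iso G G" "\<phi> a = u" "\<phi> b = v"
    "\<phi> ` generate G {a} = generate G {x}" "\<phi> ` generate G {b} = generate G {y}"
proof -
  have p_pow: "x [^] p = \<one>" "y [^] p = \<one>" using xyz(4) relations by (auto simp: doubleton_eq_iff)
  have dvd: "p dvd k" if "x [^] k = \<one> \<or> y [^] k = \<one>" for k :: nat
    using that xyz(4) exponents_mod_p[of k 0] exponents_mod_p[of 0 k] by (auto simp: doubleton_eq_iff)
  obtain i where i: "u = x [^] i" "i \<in> {1..p - 1}"
    using u nontrivial_powers[OF xyz(1) p_pow(1)] dvd by blast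
  obtain j where j: "v = y [^] j" "j \<in> {1..p - 1}"
    using v nontrivial_powers[OF xyz(2) p_pow(2)] dvd by blast
  have central: "z [^] k \<otimes> s [^] l = s [^] l \<otimes> z [^] k" if "s = x \<or> s = y" for s and k l :: nat
  proof -
    have s: "s \<in> carrier G" "z \<otimes> s = s \<otimes> z" using that xyz zx zy by auto
    then have "z [^] k \<otimes> s = s \<otimes> z [^] k" using group_commutes_pow xyz(3) by blast
    then show ?thesis using group_commutes_pow[of s "z [^] k" l] s(1) xyz(3) by simp
  qed
  \<comment> \<open>By \<open>commute_pow_pow\<close> the commutator of \<open>u = x [^] i\<close>
    and \<open>v = y [^] j\<close> is \<open>z [^] (i * j)\<close>, so this is where
    \<open>c\<close> has to go; \<open>central\<close> gives the remaining commutation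
    relations.\<close>
  obtain \<phi> where \<phi>: "\<phi> \<in> hom G G" "\<phi> a = u" "\<phi> b = v"
  proof (rule lift[of G u v "z [^] (i * j)"])
    show "u \<otimes> v = v \<otimes> (u \<otimes> z [^] (i * j))"
      unfolding i(1) j(1) by (rule commute_pow_pow[OF xyz(1-3) xy zx zy])
  qed (use i j xyz z p_pow central in \<open>simp_all add: pow_pow_eq_one group_axioms\<close>)
  interpret \<phi>: group_hom G G \<phi> by unfold_locales (rule \<phi>(1))
  \<comment> \<open>Some powers of \<open>u\<close> and \<open>v\<close> are \<open>x\<close> and
    \<open>y\<close>, that is \<open>a\<close> and \<open>b\<close> in some order; both therefore
    lie in the image, as \<open>endomorphism_iso\<close> requires.\<close>
  obtain m :: nat where "u [^] m = x" using power_generates[OF xyz(1) p_pow(1) i(2)] i(1) by blast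
  then have "x \<in> \<phi> ` carrier G" using \<phi>(2) \<phi>.hom_nat_pow[of a m] by (metis gens_closed(1) imageI nat_pow_closed)
  moreover obtain n :: nat where "v [^] n = y" using power_generates[OF xyz(2) p_pow(2) j(2)] j(1) by blast
  then have "y \<in> \<phi> ` carrier G" using \<phi>(3) \<phi>.hom_nat_pow[of b n] by (metis gens_closed(2) imageI nat_pow_closed)
  ultimately have "\<phi> \<in> iso G G"
    using xyz(4) endomorphism_iso[OF \<phi>(1)] by (auto simp: doubleton_eq_iff)
  moreover have "\<phi> ` generate G {a} = generate G {x}"
    using \<phi>.generate_img[of "{a}"] \<phi>(2) i generate_power[OF xyz(1) p_pow(1)] by simp
  moreover have "\<phi> ` generate G {b} = generate G {y}"
    using \<phi>.generate_img[of "{b}"] \<phi>(3) j generate_power[OF xyz(2) p_pow(2)] by simp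
  ultimately show thesis using that \<phi>(2,3) by blast
qed

text \<open>These are the hypotheses of \<open>automorphism_exists\<close> for the exchanged
  generators; exchanging the entries of a commutator inverts it.\<close>

lemma swapped_relations:
  "inv c [^] p = \<one>" "b \<otimes> a = a \<otimes> (b \<otimes> inv c)" "inv c \<otimes> a = a \<otimes> inv c" "inv c \<otimes> b = b \<otimes> inv c"
proof -
  show "inv c [^] p = \<one>" using relations(3) by (simp add: nat_pow_inv)
  show cb: "inv c \<otimes> b = b \<otimes> inv c" using relations(6)
    by (metis gens_closed(2,3) inv_closed inv_solve_left' inv_solve_right m_assoc m_closed)
  show "inv c \<otimes> a = a \<otimes> inv c" using relations(5)
    by (metis gens_closed(1,3) inv_closed inv_solve_left' inv_solve_right m_assoc m_closed)
  have "a \<otimes> (b \<otimes> inv c) = (a \<otimes> b) \<otimes> inv c" by (simp add: m_assoc)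
  also have "\<dots> = b \<otimes> a" unfolding relations(4) by (simp add: m_assoc)
  finally show "b \<otimes> a = a \<otimes> (b \<otimes> inv c)" by simp
qed

text \<open>A common element is both a power of \<open>a\<close> and a power of \<open>b\<close>, so
  the coordinate maps force its exponents to be multiples of \<open>p\<close>.\<close>

lemma generate_a_Int_generate_b: "generate G {a} \<inter> generate G {b} = {\<one>}"
proof
  show "generate G {a} \<inter> generate G {b} \<subseteq> {\<one>}"
  proof
    fix x assume "x \<in> generate G {a} \<inter> generate G {b}"
    then obtain i j :: nat where ij: "x = a [^] i" "x = b [^] j"
      unfolding generate_eq_powers[OF gens_closed(1)] generate_eq_powers[OF gens_closed(2)] by blast
    then have "p dvd i" using exponents_mod_p by metis
    then show "x \<in> {\<one>}" using ij(1) pow_mod_p[OF gens_closed(1) relations(1), of i] by simp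
  qed
qed (simp add: generate.one)

end


theorem corollary1p3:
  fixes p :: nat
    and R :: "(gen word \<times> gen word) set"
    and G :: "gen word set monoid"
    and a b :: "gen word set"
    and S :: "gen word set set"
    and \<Gamma> :: "gen word set pair_pre_digraph"
    and \<Sigma> :: "gen word set set pair_pre_digraph"
  assumes "prime p" and "odd p"
    and "R = extraspecial_relations p"
    and "G = presented_group R"
    and "a = pres_gen R Gen_a" and "b = pres_gen R Gen_b"
    and "S = {a [^]\<^bsub>G\<^esub> i | i. i \<in> {1..p - 1}} \<union> {b [^]\<^bsub>G\<^esub> i | i. i \<in> {1..p - 1}}"
    and "\<Gamma> = Cay G S"
    and "\<Sigma> = Cos G (generate G {a}) (generate G {b})"
  shows "pair_graph \<Gamma> \<and> pair_graph \<Sigma>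
    \<and> digraph_iso (with_proj \<Gamma>) (with_proj (line_graph \<Sigma>))
    \<and> s_arc_transitive \<Sigma> 3"
proof -
  interpret extraspecial_group p G a b "pres_gen R Gen_c"
    using assms by unfold_locales simp_all
  let ?H = "generate G {a}" and ?K = "generate G {b}"
  have H: "subgroup ?H G" and K: "subgroup ?K G" by (simp_all add: generate_is_subgroup)
  \<comment> \<open>With the other exponent set to 0, \<open>exponents_mod_p\<close> bounds the
    orders of \<open>a\<close> and \<open>b\<close> from below by \<open>p\<close>.\<close>
  have "p dvd k" if "a [^]\<^bsub>G\<^esub> k = \<one>\<^bsub>G\<^esub> \<or> b [^]\<^bsub>G\<^esub> k = \<one>\<^bsub>G\<^esub>" for k :: nat
    using that exponents_mod_p[of k 0] exponents_mod_p[of 0 k] by auto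
  then have powers: "?H - {\<one>\<^bsub>G\<^esub>} = {a [^]\<^bsub>G\<^esub> i | i. i \<in> {1..p - 1}}"
      "?K - {\<one>\<^bsub>G\<^esub>} = {b [^]\<^bsub>G\<^esub> i | i. i \<in> {1..p - 1}}"
    using nontrivial_powers relations(1,2) by simp_all
  have S: "S = ?H \<union> ?K - {\<one>\<^bsub>G\<^esub>}" unfolding assms(7) Un_Diff powers ..
  \<comment> \<open>The exponent 1 is admissible, so \<open>a\<close> and \<open>b\<close> can serve
    as the base elements \<open>h0\<close> and \<open>k0\<close>.\<close>
  have "1 \<in> {1..p - 1}" using prime_ge_2_nat[OF p] by simp
  then have a: "a \<in> ?H - {\<one>\<^bsub>G\<^esub>}" and b: "b \<in> ?K - {\<one>\<^bsub>G\<^esub>}"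
    unfolding powers using nat_pow_eone[OF gens_closed(1)] nat_pow_eone[OF gens_closed(2)] by force+
  then have "?H \<noteq> ?K" using generate_a_Int_generate_b by blast
  have "pair_graph \<Gamma>"
    unfolding assms(8)
  proof (rule pair_graph_Cay[OF finite_carrier])
    show "inv\<^bsub>G\<^esub> s \<in> S" if "s \<in> S" for s
      using that H K unfolding S by (auto simp: subgroup.m_inv_closed dest: subgroup.mem_carrier)
  qed (simp add: S)
  moreover have "pair_graph \<Sigma>"
    unfolding assms(9) by (rule pair_graph_Cos[OF finite_carrier H K \<open>?H \<noteq> ?K\<close>])
  moreover have "digraph_iso (with_proj \<Gamma>) (with_proj (line_graph \<Sigma>))"
    unfolding assms(8,9) S
    by (rule Cay_iso_line_graph_Cos[OF finite_carrier H K generate_a_Int_generate_b \<open>?H \<noteq> ?K\<close>])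
  moreover have "s_arc_transitive \<Sigma> 3"
    unfolding assms(9)
  proof (rule s_arc_transitive_Cos[OF H K generate_a_Int_generate_b a b])
    fix h k assume h: "h \<in> ?H - {\<one>\<^bsub>G\<^esub>}" and k: "k \<in> ?K - {\<one>\<^bsub>G\<^esub>}"
    show "\<exists>\<phi>\<in>iso G G. \<phi> ` ?H = ?H \<and> \<phi> ` ?K = ?K \<and> \<phi> a = h \<and> \<phi> b = k"
      by (rule automorphism_exists[OF gens_closed HOL.refl relations(3-6) h k]) blast
    \<comment> \<open>Here \<open>(x, y, z)\<close> is \<open>(b, a, inv c)\<close>. The last two
      relations are taken in the order \<open>(4,3)\<close> because commutation with
      \<open>x = b\<close> is asked for first.\<close>
    show "\<exists>\<phi>\<in>iso G G. \<phi> ` ?H = ?K \<and> \<phi> ` ?K = ?H \<and> \<phi> a = k \<and> \<phi> b = h"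
      by (rule automorphism_exists[OF gens_closed(2,1) inv_closed[OF gens_closed(3)] insert_commute
            swapped_relations(1,2,4,3) k h]) blast
  qed
  ultimately show ?thesis by blast
qed

end
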